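(* Let $\Gamma=(G,\sigma)$ be a signed graph. Then $$\frac{\lambda_1(L^{\sigma})}{2}\leq h_1^{\sigma}(\mu_1)\leq \sqrt{2d_{\max}\lambda_1(L^{\sigma})},$$ where $d_{\max}=\max_{u\in V}d_u$.
   Context: A signed graph $\Gamma=(G,\sigma)$ consists of a finite simple undirected graph $G=(V,E)$ with $N=|V|$ vertices, positive symmetric edge weights $w_{uv}>0$ for $\{u,v\}\in E$ ($w_{uv}=0$ otherwise), and a signature $\sigma:E\to\{+1,-1\}$; write $\sigma(uv)=\sigma(\{u,v\})$. The degree is $d_u=\sum_v w_{uv}$, $D=\mathrm{diag}(d_u)$, $A^{\sigma}_{uv}=\sigma(uv)w_{uv}$ for edges and $0$ otherwise, and $L^\sigma=D-A^\sigma$ with eigenvalues $\lambda_1(L^\sigma)\le\cdots\le\lambda_N(L^\sigma)$. $\mu_1$ is the constant measure $\mu_1\equiv1$ on $V$, and for a positive measure $\mu$, $\mathrm{vol}_\mu(S)=\sum_{u\in S}\mu(u)$. For $V_1,V_2\subseteq V$, $|E(V_1,V_2)|=\sum_{u\in V_1}\sum_{v\in V_2}w_{uv}$, $|E^{\pm}(V_1,V_2)|=\sum_{u\in V_1}\sum_{v\in V_2,\sigma(uv)=\pm1}w_{uv}$, $|E^\pm(V_1)|=|E^\pm(V_1,V_1)|$. For disjoint $V_1,V_2$ with $V_1\cup V_2\ne\emptyset$, $$\beta^{\sigma}(V_1,V_2)=\frac{2|E^{+}(V_1,V_2)|+|E^-(V_1)|+|E^-(V_2)|+|E(V_1\cup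 V_2,\overline{V_1\cup V_2})|}{\mathrm{vol}_{\mu}(V_1\cup V_2)},$$ and $h_1^\sigma(\mu)$ is its minimum over all such pairs. *)

theory Defs
  imports "HOL-Analysis.Analysis"
begin

text \<open>The vertex set is the (finite, nonempty) type \<open>'v\<close>. The signature is only meaningful on edges;
  its values elsewhere are unconstrained, so every use below is guarded by the edge set.\<close>

record 'v weighted_signed_graph =
  edges :: "'v set set"
  weight :: "'v \<Rightarrow> 'v \<Rightarrow> real"
  signature :: "'v set \<Rightarrow> int"

definition signed_graph :: "'v weighted_signed_graph \<Rightarrow> bool" where
  "signed_graph \<Gamma> \<longleftrightarrow>
     (\<forall>e \<in> edges \<Gamma>. card e = 2) \<and>
     (\<forall>u v. weight \<Gamma> u v = weight \<Gamma> v u) \<and>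
     (\<forall>u v. {u, v} \<in> edges \<Gamma> \<longrightarrow> weight \<Gamma> u v > 0) \<and>
     (\<forall>u v. {u, v} \<notin> edges \<Gamma> \<longrightarrow> weight \<Gamma> u v = 0) \<and>
     (\<forall>e \<in> edges \<Gamma>. signature \<Gamma> e \<in> {1, -1})"

definition degree :: "('v::finite) weighted_signed_graph \<Rightarrow> 'v \<Rightarrow> real" where
  "degree \<Gamma> u = (\<Sum>v\<in>UNIV. weight \<Gamma> u v)"

definition max_degree :: "('v::finite) weighted_signed_graph \<Rightarrow> real" where
  "max_degree \<Gamma> = Max (range (degree \<Gamma>))"

definition degree_matrix :: "('v::finite) weighted_signed_graph \<Rightarrow> real^'v^'v" where
  "degree_matrix \<Gamma> = (\<chi> u v. if u = v then degree \<Gamma> u else 0)"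

definition signed_adjacency :: "('v::finite) weighted_signed_graph \<Rightarrow> real^'v^'v" where
  "signed_adjacency \<Gamma> =
     (\<chi> u v. if {u, v} \<in> edges \<Gamma> then of_int (signature \<Gamma> {u, v}) * weight \<Gamma> u v else 0)"

definition signed_laplacian :: "('v::finite) weighted_signed_graph \<Rightarrow> real^'v^'v" where
  "signed_laplacian \<Gamma> = degree_matrix \<Gamma> - signed_adjacency \<Gamma>"

definition eigenvalue :: "real^'n^'n \<Rightarrow> real \<Rightarrow> bool" where
  "eigenvalue M l \<longleftrightarrow> (\<exists>x. x \<noteq> 0 \<and> M *v x = l *\<^sub>R x)"

text \<open>The first entry in the increasing list of eigenvalues. It is used for symmetric matrices only,
  whose set of real eigenvalues is finite and nonempty.\<close>

definition lambda_1 :: "real^'n^'n \<Rightarrow> real" where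
  "lambda_1 M = Min {l. eigenvalue M l}"

text \<open>The edge weights sum over ordered pairs of vertices, so an edge with both ends in \<open>V\<^sub>1 \<inter> V\<^sub>2\<close>
  counts twice. In \<open>sgn_edge_weight\<close> the argument \<open>s\<close> is the sign \<open>1\<close> or \<open>-1\<close>.\<close>

definition edge_weight :: "('v::finite) weighted_signed_graph \<Rightarrow> 'v set \<Rightarrow> 'v set \<Rightarrow> real" where
  "edge_weight \<Gamma> V\<^sub>1 V\<^sub>2 = (\<Sum>u\<in>V\<^sub>1. \<Sum>v\<in>V\<^sub>2. weight \<Gamma> u v)"

definition sgn_edge_weight ::
  "int \<Rightarrow> ('v::finite) weighted_signed_graph \<Rightarrow> 'v set \<Rightarrow> 'v set \<Rightarrow> real" where
  "sgn_edge_weight s \<Gamma> V\<^sub>1 V\<^sub>2 =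
     (\<Sum>u\<in>V\<^sub>1. \<Sum>v \<in> {v\<in>V\<^sub>2. {u, v} \<in> edges \<Gamma> \<and> signature \<Gamma> {u, v} = s}. weight \<Gamma> u v)"

definition vol :: "('v::finite \<Rightarrow> real) \<Rightarrow> 'v set \<Rightarrow> real" where
  "vol \<mu> S = (\<Sum>u\<in>S. \<mu> u)"

definition const_measure :: "'v \<Rightarrow> real" where
  "const_measure = (\<lambda>_. 1)"

definition signed_beta ::
  "('v::finite) weighted_signed_graph \<Rightarrow> ('v \<Rightarrow> real) \<Rightarrow> 'v set \<Rightarrow> 'v set \<Rightarrow> real" where
  "signed_beta \<Gamma> \<mu> V\<^sub>1 V\<^sub>2 =
     (2 * sgn_edge_weight 1 \<Gamma> V\<^sub>1 V\<^sub>2 + sgn_edge_weight (-1) \<Gamma> V\<^sub>1 V\<^sub>1 + sgn_edge_weight (-1) \<Gamma> V\<^sub>2 V\<^sub>2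
       + edge_weight \<Gamma> (V\<^sub>1 \<union> V\<^sub>2) (- (V\<^sub>1 \<union> V\<^sub>2))) / vol \<mu> (V\<^sub>1 \<union> V\<^sub>2)"

definition signed_cheeger :: "('v::finite) weighted_signed_graph \<Rightarrow> ('v \<Rightarrow> real) \<Rightarrow> real" where
  "signed_cheeger \<Gamma> \<mu> =
     Min {signed_beta \<Gamma> \<mu> V\<^sub>1 V\<^sub>2 | V\<^sub>1 V\<^sub>2. V\<^sub>1 \<inter> V\<^sub>2 = {} \<and> V\<^sub>1 \<union> V\<^sub>2 \<noteq> {}}"

end

theory Submission
  imports Defs
begin

text \<open>
  For \<open>y = 1\<^bsub>V\<^sub>1\<^esub> - 1\<^bsub>V\<^sub>2\<^esub>\<close> the numerator of \<open>\<beta>(V\<^sub>1, V\<^sub>2)\<close> is the total variation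
  \<open>1/2 \<Sum> w\<^bsub>uv\<^esub> |y\<^sub>u - \<sigma>\<^bsub>uv\<^esub> y\<^sub>v|\<close>, while the quadratic form of the Laplacian is
  \<open>1/2 \<Sum> w\<^bsub>uv\<^esub> (x\<^sub>u - \<sigma>\<^bsub>uv\<^esub> x\<^sub>v)\<^sup>2\<close>. Testing the Rayleigh quotient on \<open>y\<close> gives the lower bound.
  Conversely, decomposing a function \<open>g\<close> into its level sets shows that the total variation of \<open>g\<close>
  is at least \<open>h \<Sum> |g\<^sub>u|\<close>; for \<open>g = x |x|\<close> with \<open>x\<close> a bottom eigenvector, the Cauchy-Schwarz
  inequality yields the upper bound.
\<close>

section \<open>The smallest eigenvalue of a symmetric matrix\<close>

lemma symmetric_matrix_inner:
  fixes M :: "real^'n^'n"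
  assumes "transpose M = M"
  shows "x \<bullet> (M *v y) = (M *v x) \<bullet> y"
  using assms by (metis dot_lmul_matrix vector_transpose_matrix)

text \<open>Eigenvectors to distinct eigenvalues are orthogonal, hence independent, and a
  finite-dimensional space has room for only finitely many. This is what gives the
  \<open>Min\<close> in \<open>lambda_1\<close> its intended meaning.\<close>

lemma finite_eigenvalues_symmetric:
  fixes M :: "real^'n^'n"
  assumes sym: "transpose M = M"
  shows "finite {l. eigenvalue M l}"
proof -
  define e where "e l = (SOME x. x \<noteq> 0 \<and> M *v x = l *\<^sub>R x)" for l
  have e: "e l \<noteq> 0 \<and> M *v e l = l *\<^sub>R e l" if "eigenvalue M l" for l
    unfolding e_def by (rule someI_ex) (use that in \<open>auto simp: eigenvalue_def\<close>)
  have orth: "e k \<bullet> e l = 0" if "eigenvalue M k" "eigenvalue M l" "k \<noteq> l" for k l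
    using symmetric_matrix_inner[OF sym, of "e k" "e l"] e[OF that(1)] e[OF that(2)] that(3)
    by simp
  \<comment> \<open>An eigenvector shared by two distinct eigenvalues would be orthogonal to itself,
    hence zero.\<close>
  have inj: "inj_on e {l. eigenvalue M l}"
    by (rule inj_onI) (metis e inner_eq_zero_iff mem_Collect_eq orth)
  have "pairwise orthogonal (e ` {l. eigenvalue M l})"
    unfolding pairwise_def orthogonal_def using orth by fastforce
  moreover have "0 \<notin> e ` {l. eigenvalue M l}"
    using e by fastforce
  ultimately have "independent (e ` {l. eigenvalue M l})"
    by (rule pairwise_orthogonal_independent)
  then have "finite (e ` {l. eigenvalue M l})"
    by (rule independent_imp_finite)
  then show ?thesis
    using inj by (rule finite_imageD)
qed

text \<open>First-order condition: the polynomial vanishes at \<open>t = 0\<close>, so nonnegativity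
  makes \<open>0\<close> a minimum and the derivative there is zero.\<close>

lemma linear_coeff_zero_if_nonneg:
  fixes a b :: real
  assumes "\<And>t. 0 \<le> 2 * t * a + t\<^sup>2 * b"
  shows "a = 0"
proof (rule ccontr)
  assume "a \<noteq> 0"
  have b: "b \<ge> 0"
    using assms[of 1] assms[of "-1"] by simp
  \<comment> \<open>For \<open>b > 0\<close> the minimiser is \<open>- a / b\<close>; the shift to
    \<open>b + 1\<close> also covers \<open>b = 0\<close> and still gives a negative value.\<close>
  define t where "t = - a / (b + 1)"
  have a: "a = - t * (b + 1)" and t: "t \<noteq> 0"
    using b \<open>a \<noteq> 0\<close> by (auto simp: t_def)
  have "2 * t * a + t\<^sup>2 * b = - (t\<^sup>2 * (b + 2))"
    by (simp add: a algebra_simps power2_eq_square)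
  also have "\<dots> < 0"
    using b t by simp
  finally show False
    using assms[of t] by simp
qed

text \<open>Rayleigh's principle: the quadratic form attains its minimum on the compact unit sphere,
  the minimiser is an eigenvector by first variation, and any other eigenvalue is bounded below by
  testing the form on its eigenvector.\<close>

lemma symmetric_eigenvalue_minimum:
  fixes M :: "real^'n^'n"
  assumes sym: "transpose M = M"
  obtains x where "norm x = 1" "M *v x = lambda_1 M *\<^sub>R x"
    "\<And>y. lambda_1 M * (y \<bullet> y) \<le> y \<bullet> (M *v y)"
proof -
  have "continuous_on (sphere 0 1) (\<lambda>x. x \<bullet> (M *v x))"
    by (intro continuous_intros matrix_vector_mult_linear_continuous_on)
  moreover have "sphere (0::real^'n) 1 \<noteq> {}"
    by simp
  ultimately obtain x where x: "norm x = 1" 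
    and xmin: "\<And>y. norm y = 1 \<Longrightarrow> x \<bullet> (M *v x) \<le> y \<bullet> (M *v y)"
    using continuous_attains_inf[of "sphere (0::real^'n) 1" "\<lambda>x. x \<bullet> (M *v x)"]
    by auto
  define m where "m = x \<bullet> (M *v x)"
  have low: "m * (y \<bullet> y) \<le> y \<bullet> (M *v y)" for y
  proof (cases "y = 0")
    case False
    have "m \<le> (y /\<^sub>R norm y) \<bullet> (M *v (y /\<^sub>R norm y))"
      unfolding m_def by (rule xmin) (use False in simp)
    also have "\<dots> = y \<bullet> (M *v y) / (norm y)\<^sup>2"
      by (simp add: matrix_vector_mult_scaleR power2_eq_square divide_inverse)
    finally show ?thesis
      using False by (simp add: field_simps power2_norm_eq_inner)
  qed simp
  have ev: "M *v x = m *\<^sub>R x"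
  proof -
    \<comment> \<open>The form of \<open>M - m I\<close> is nonnegative everywhere and zero at
      \<open>x\<close>, so its linear term at \<open>x\<close> vanishes in every direction
      \<open>y\<close>.\<close>
    have "y \<bullet> (M *v x - m *\<^sub>R x) = 0" for y
    proof (rule linear_coeff_zero_if_nonneg)
      fix t :: real
      have "(x + t *\<^sub>R y) \<bullet> (M *v (x + t *\<^sub>R y)) - m * ((x + t *\<^sub>R y) \<bullet> (x + t *\<^sub>R y))
        = x \<bullet> (M *v x) - m * (x \<bullet> x) + 2 * t * (y \<bullet> (M *v x - m *\<^sub>R x))
            + t\<^sup>2 * (y \<bullet> (M *v y) - m * (y \<bullet> y))"
        using symmetric_matrix_inner[OF sym, of x y]
        by (simp add: matrix_vector_mult_scaleR matrix_vector_right_distrib inner_add inner_diff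
            inner_commute algebra_simps power2_eq_square)
      moreover have "x \<bullet> (M *v x) - m * (x \<bullet> x) = 0"
        using x by (simp add: m_def norm_eq_1)
      ultimately show "0 \<le> 2 * t * (y \<bullet> (M *v x - m *\<^sub>R x))
            + t\<^sup>2 * (y \<bullet> (M *v y) - m * (y \<bullet> y))"
        using low[of "x + t *\<^sub>R y"] by simp
    qed
    then show ?thesis
      by (metis eq_iff_diff_eq_0 inner_eq_zero_iff)
  qed
  have "lambda_1 M = m"
    unfolding lambda_1_def
  proof (rule Min_eqI[OF finite_eigenvalues_symmetric[OF sym]])
    fix l assume "l \<in> {l. eigenvalue M l}"
    then obtain z where "z \<noteq> 0" "M *v z = l *\<^sub>R z"
      by (auto simp: eigenvalue_def)
    then show "m \<le> l"
      using low[of z] by simp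
  next
    show "m \<in> {l. eigenvalue M l}"
      using ev x(1) by (auto simp: eigenvalue_def intro!: exI[of _ x])
  qed
  then show ?thesis
    using that x ev low by simp
qed

section \<open>Quadratic form and total variation\<close>

text \<open>The division by 2 compensates for ordered pairs counting each edge twice. In a signed
  graph the weight vanishes off the edges, which silences the arbitrary values of the signature
  there.\<close>

definition total_variation :: "('v::finite) weighted_signed_graph \<Rightarrow> ('v \<Rightarrow> real) \<Rightarrow> real" where
  "total_variation \<Gamma> g =
     (\<Sum>u\<in>UNIV. \<Sum>v\<in>UNIV. weight \<Gamma> u v * \<bar>g u - of_int (signature \<Gamma> {u, v}) * g v\<bar>) / 2"

context
  fixes \<Gamma> :: "('v::finite) weighted_signed_graph"
  assumes graph: "signed_graph \<Gamma>"
begin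

lemma weight_commute: "weight \<Gamma> u v = weight \<Gamma> v u"
  using graph by (auto simp: signed_graph_def)

lemma weight_nonneg: "weight \<Gamma> u v \<ge> 0"
  using graph unfolding signed_graph_def by (metis less_eq_real_def)

lemma weight_nonedge: "{u, v} \<notin> edges \<Gamma> \<Longrightarrow> weight \<Gamma> u v = 0"
  using graph by (auto simp: signed_graph_def)

lemma signature_cases:
  assumes "{u, v} \<in> edges \<Gamma>"
  obtains "signature \<Gamma> {u, v} = 1" | "signature \<Gamma> {u, v} = -1"
  using graph assms by (auto simp: signed_graph_def)

lemma sum_swap_weight:
  "(\<Sum>u\<in>UNIV. \<Sum>v\<in>UNIV. weight \<Gamma> u v * f u v) = (\<Sum>u\<in>UNIV. \<Sum>v\<in>UNIV. weight \<Gamma> u v * f v u)"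
  by (subst sum.swap) (simp add: weight_commute)

lemma sum_weight_left: "(\<Sum>u\<in>UNIV. \<Sum>v\<in>UNIV. weight \<Gamma> u v * f u) = (\<Sum>u\<in>UNIV. degree \<Gamma> u * f u)"
  by (simp add: degree_def sum_distrib_right)

lemma sum_weight_right: "(\<Sum>u\<in>UNIV. \<Sum>v\<in>UNIV. weight \<Gamma> u v * f v) = (\<Sum>u\<in>UNIV. degree \<Gamma> u * f u)"
  by (subst sum_swap_weight) (rule sum_weight_left)

lemma transpose_signed_laplacian: "transpose (signed_laplacian \<Gamma>) = signed_laplacian \<Gamma>"
  by (auto simp: vec_eq_iff transpose_def signed_laplacian_def degree_matrix_def
      signed_adjacency_def weight_commute insert_commute)

text \<open>On an edge the squared sign is 1, so expanding the square leaves one degree term for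
  each endpoint and twice the adjacency term.\<close>

lemma inner_signed_laplacian:
  "x \<bullet> (signed_laplacian \<Gamma> *v x) =
     (\<Sum>u\<in>UNIV. \<Sum>v\<in>UNIV. weight \<Gamma> u v * (x$u - of_int (signature \<Gamma> {u, v}) * x$v)\<^sup>2) / 2"
proof -
  let ?s = "\<lambda>u v. real_of_int (signature \<Gamma> {u, v})"
  have A: "signed_adjacency \<Gamma> $ u $ v = ?s u v * weight \<Gamma> u v" for u v
    by (simp add: signed_adjacency_def weight_nonedge)
  have "(signed_laplacian \<Gamma> *v x) $ u
      = degree \<Gamma> u * x$u - (\<Sum>v\<in>UNIV. ?s u v * weight \<Gamma> u v * x$v)" for u
    by (simp add: signed_laplacian_def matrix_vector_mult_diff_rdistrib matrix_vector_mult_def A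
        degree_matrix_def left_diff_distrib sum_subtractf if_distrib[where f = "\<lambda>t. t * _"] cong: if_cong)
  then have "x \<bullet> (signed_laplacian \<Gamma> *v x) = (\<Sum>u\<in>UNIV. degree \<Gamma> u * (x$u)\<^sup>2)
      - (\<Sum>u\<in>UNIV. \<Sum>v\<in>UNIV. weight \<Gamma> u v * (?s u v * x$u * x$v))"
    by (simp add: inner_vec_def right_diff_distrib sum_subtractf sum_distrib_left power2_eq_square
        mult_ac)
  moreover have "weight \<Gamma> u v * (x$u - ?s u v * x$v)\<^sup>2 = weight \<Gamma> u v * (x$u)\<^sup>2
      + weight \<Gamma> u v * (x$v)\<^sup>2 - 2 * (weight \<Gamma> u v * (?s u v * x$u * x$v))" for u v
  proof (cases "{u, v} \<in> edges \<Gamma>")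
    case True
    then show ?thesis
      by (cases rule: signature_cases) (auto simp: power2_eq_square algebra_simps)
  qed (simp add: weight_nonedge)
  ultimately show ?thesis
    by (simp add: sum.distrib sum_subtractf sum_weight_left sum_weight_right
        flip: sum_distrib_left)
qed

text \<open>Half the difference at an ordered pair is 1 for a positive edge between the two sets or
  a negative edge inside one of them, 1/2 for an edge leaving the union, and 0 for every other
  edge.\<close>

lemma beta_numerator_eq_total_variation:
  assumes disj: "V\<^sub>1 \<inter> V\<^sub>2 = {}"
  shows "2 * sgn_edge_weight 1 \<Gamma> V\<^sub>1 V\<^sub>2 + sgn_edge_weight (-1) \<Gamma> V\<^sub>1 V\<^sub>1
      + sgn_edge_weight (-1) \<Gamma> V\<^sub>2 V\<^sub>2 + edge_weight \<Gamma> (V\<^sub>1 \<union> V\<^sub>2) (- (V\<^sub>1 \<union> V\<^sub>2))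
    = total_variation \<Gamma> (\<lambda>u. indicator V\<^sub>1 u - indicator V\<^sub>2 u)"
proof -
  let ?p = "\<lambda>s u v. if signature \<Gamma> {u, v} = s then 1 else 0 :: real"
  let ?y = "\<lambda>u. indicator V\<^sub>1 u - indicator V\<^sub>2 u :: real"
  let ?S = "\<lambda>f. \<Sum>u\<in>UNIV. \<Sum>v\<in>UNIV. weight \<Gamma> u v * f u v"
  have sgn: "sgn_edge_weight s \<Gamma> A B
      = ?S (\<lambda>u v. indicator A u * indicator B v * ?p s u v)" for s A B
  proof -
    have "(\<Sum>v\<in>UNIV. weight \<Gamma> u v * (indicator A u * indicator B v * ?p s u v))
      = indicator A u * (\<Sum>v \<in> {v\<in>B. {u, v} \<in> edges \<Gamma> \<and> signature \<Gamma> {u, v} = s}. weight \<Gamma> u v)" for u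
      unfolding sum_distrib_left
      by (rule sum.mono_neutral_cong_right) (use weight_nonedge in \<open>auto simp: indicator_def\<close>)
    then show ?thesis
      unfolding sgn_edge_weight_def
      by (simp add: indicator_def if_distrib[where f = "\<lambda>t. t * _"] sum.If_cases cong: if_cong)
  qed
  have edge: "edge_weight \<Gamma> A B = ?S (\<lambda>u v. indicator A u * indicator B v)" for A B
  proof -
    have "(\<Sum>v\<in>UNIV. weight \<Gamma> u v * (indicator A u * indicator B v))
      = indicator A u * (\<Sum>v\<in>B. weight \<Gamma> u v)" for u
      unfolding sum_distrib_left
      by (rule sum.mono_neutral_cong_right) (auto simp: indicator_def)
    then show ?thesis
      unfolding edge_weight_def
      by (simp add: indicator_def if_distrib[where f = "\<lambda>t. t * _"] sum.If_cases cong: if_cong)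
  qed
  \<comment> \<open>The integrand of the total variation is symmetric in \<open>u\<close> and
    \<open>v\<close>. The cross term and the boundary term are symmetrised as well, so that both
    sides can be compared pair by pair.\<close>
  have sym1: "2 * sgn_edge_weight 1 \<Gamma> V\<^sub>1 V\<^sub>2 = ?S (\<lambda>u v. indicator V\<^sub>1 u * indicator V\<^sub>2 v * ?p 1 u v)
      + ?S (\<lambda>u v. indicator V\<^sub>1 v * indicator V\<^sub>2 u * ?p 1 u v)"
    using sgn[of 1 V\<^sub>1 V\<^sub>2] sum_swap_weight[of "\<lambda>u v. indicator V\<^sub>1 u * indicator V\<^sub>2 v * ?p 1 u v"]
    by (simp only: insert_commute mult_2)
  have sym2: "edge_weight \<Gamma> (V\<^sub>1 \<union> V\<^sub>2) (- (V\<^sub>1 \<union> V\<^sub>2))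
    = ?S (\<lambda>u v. indicator (V\<^sub>1 \<union> V\<^sub>2) u * indicator (- (V\<^sub>1 \<union> V\<^sub>2)) v / 2)
      + ?S (\<lambda>u v. indicator (V\<^sub>1 \<union> V\<^sub>2) v * indicator (- (V\<^sub>1 \<union> V\<^sub>2)) u / 2)"
    using edge[of "V\<^sub>1 \<union> V\<^sub>2" "- (V\<^sub>1 \<union> V\<^sub>2)"]
      sum_swap_weight[of "\<lambda>u v. indicator (V\<^sub>1 \<union> V\<^sub>2) u * indicator (- (V\<^sub>1 \<union> V\<^sub>2)) v / 2"]
    by (simp only: times_divide_eq_right flip: sum_divide_distrib)
  have "weight \<Gamma> u v * (indicator V\<^sub>1 u * indicator V\<^sub>2 v * ?p 1 u v)
      + weight \<Gamma> u v * (indicator V\<^sub>1 v * indicator V\<^sub>2 u * ?p 1 u v)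
      + weight \<Gamma> u v * (indicator V\<^sub>1 u * indicator V\<^sub>1 v * ?p (-1) u v)
      + weight \<Gamma> u v * (indicator V\<^sub>2 u * indicator V\<^sub>2 v * ?p (-1) u v)
      + (weight \<Gamma> u v * (indicator (V\<^sub>1 \<union> V\<^sub>2) u * indicator (- (V\<^sub>1 \<union> V\<^sub>2)) v / 2)
      + weight \<Gamma> u v * (indicator (V\<^sub>1 \<union> V\<^sub>2) v * indicator (- (V\<^sub>1 \<union> V\<^sub>2)) u / 2))
    = weight \<Gamma> u v * \<bar>?y u - of_int (signature \<Gamma> {u, v}) * ?y v\<bar> / 2" for u v
  proof (cases "{u, v} \<in> edges \<Gamma>")
    case True
    then show ?thesis
      using disj by (cases rule: signature_cases; cases "u \<in> V\<^sub>1"; cases "u \<in> V\<^sub>2";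
        cases "v \<in> V\<^sub>1"; cases "v \<in> V\<^sub>2") auto
  qed (simp add: weight_nonedge)
  then show ?thesis
    unfolding sym1 sym2 unfolding sgn total_variation_def sum_divide_distrib
    by (simp only: flip: sum.distrib)
qed

lemma signed_beta_const_measure:
  assumes "V\<^sub>1 \<inter> V\<^sub>2 = {}"
  shows "signed_beta \<Gamma> const_measure V\<^sub>1 V\<^sub>2
    = total_variation \<Gamma> (\<lambda>u. indicator V\<^sub>1 u - indicator V\<^sub>2 u) / card (V\<^sub>1 \<union> V\<^sub>2)"
  unfolding signed_beta_def beta_numerator_eq_total_variation[OF assms]
  by (simp add: vol_def const_measure_def)

lemma total_variation_nonneg: "total_variation \<Gamma> g \<ge> 0"
  unfolding total_variation_def by (simp add: sum_nonneg weight_nonneg)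

end

lemma sum_indicator_UNIV: "(\<Sum>u\<in>UNIV. indicator (A :: 'a::finite set) u) = real (card A)"
  by (simp add: indicator_def sum.If_cases)

section \<open>The Cheeger constant\<close>

lemma finite_signed_betas:
  "finite {signed_beta \<Gamma> \<mu> V\<^sub>1 V\<^sub>2 | V\<^sub>1 V\<^sub>2. V\<^sub>1 \<inter> V\<^sub>2 = {} \<and> V\<^sub>1 \<union> V\<^sub>2 \<noteq> {}}"
  by (rule finite_subset[of _ "(\<lambda>(A, B). signed_beta \<Gamma> \<mu> A B) ` UNIV"]) auto

lemma signed_cheeger_le:
  "V\<^sub>1 \<inter> V\<^sub>2 = {} \<Longrightarrow> V\<^sub>1 \<union> V\<^sub>2 \<noteq> {} \<Longrightarrow> signed_cheeger \<Gamma> \<mu> \<le> signed_beta \<Gamma> \<mu> V\<^sub>1 V\<^sub>2"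
  unfolding signed_cheeger_def by (rule Min_le[OF finite_signed_betas]) blast

lemma signed_cheeger_attained:
  obtains V\<^sub>1 V\<^sub>2 where "V\<^sub>1 \<inter> V\<^sub>2 = {}" "V\<^sub>1 \<union> V\<^sub>2 \<noteq> {}" "signed_cheeger \<Gamma> \<mu> = signed_beta \<Gamma> \<mu> V\<^sub>1 V\<^sub>2"
proof -
  \<comment> \<open>The pair \<open>(UNIV, {})\<close> is admissible because a type is never
    empty.\<close>
  have "signed_beta \<Gamma> \<mu> UNIV {}
      \<in> {signed_beta \<Gamma> \<mu> V\<^sub>1 V\<^sub>2 | V\<^sub>1 V\<^sub>2. V\<^sub>1 \<inter> V\<^sub>2 = {} \<and> V\<^sub>1 \<union> V\<^sub>2 \<noteq> {}}"
    by (intro CollectI exI[of _ UNIV] exI[of _ "{}"]) simp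
  then have "{signed_beta \<Gamma> \<mu> V\<^sub>1 V\<^sub>2 | V\<^sub>1 V\<^sub>2. V\<^sub>1 \<inter> V\<^sub>2 = {} \<and> V\<^sub>1 \<union> V\<^sub>2 \<noteq> {}} \<noteq> {}"
    by (metis empty_iff)
  from Min_in[OF finite_signed_betas this] show ?thesis
    using that unfolding signed_cheeger_def mem_Collect_eq by blast
qed

section \<open>The discrete coarea inequality\<close>

text \<open>Moving a number towards 0 by \<open>m\<close> does not carry it past 0 under these
  bounds. Hence the two differences on the right never have opposite signs, and their absolute
  values add.\<close>

lemma abs_diff_level_decomposition:
  fixes a b m :: real
  assumes "m \<ge> 0" "a = 0 \<or> m \<le> \<bar>a\<bar>" "b = 0 \<or> m \<le> \<bar>b\<bar>"
  shows "\<bar>a - b\<bar> = \<bar>(a - m * sgn a) - (b - m * sgn b)\<bar> + m * \<bar>sgn a - sgn b\<bar>"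
  using assms by (auto simp: sgn_if abs_if split: if_splits)

text \<open>Multiplication by a sign commutes with \<open>sgn\<close>, so the scalar identity
  applies on each edge to \<open>g u\<close> and the signed value of \<open>g v\<close>.\<close>

lemma total_variation_level_decomposition:
  assumes graph: "signed_graph \<Gamma>"
    and m: "m \<ge> 0" "\<And>u. g u = 0 \<or> m \<le> \<bar>g u\<bar>"
  shows "total_variation \<Gamma> g
    = total_variation \<Gamma> (\<lambda>u. g u - m * sgn (g u)) + m * total_variation \<Gamma> (\<lambda>u. sgn (g u))"
proof -
  let ?s = "\<lambda>u v. real_of_int (signature \<Gamma> {u, v})"
  have "weight \<Gamma> u v * \<bar>g u - ?s u v * g v\<bar>
      = weight \<Gamma> u v * \<bar>(g u - m * sgn (g u)) - ?s u v * (g v - m * sgn (g v))\<bar>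
        + m * (weight \<Gamma> u v * \<bar>sgn (g u) - ?s u v * sgn (g v)\<bar>)" for u v
  proof (cases "{u, v} \<in> edges \<Gamma>")
    case True
    then have "\<bar>g u - ?s u v * g v\<bar>
      = \<bar>(g u - m * sgn (g u)) - ?s u v * (g v - m * sgn (g v))\<bar>
        + m * \<bar>sgn (g u) - ?s u v * sgn (g v)\<bar>"
      using abs_diff_level_decomposition[of m "g u" "?s u v * g v"] m(1) m(2)[of u] m(2)[of v]
      by (cases rule: signature_cases[OF graph]) (auto simp: sgn_minus algebra_simps)
    then show ?thesis
      by (simp add: algebra_simps)
  qed (simp add: weight_nonedge[OF graph])
  then show ?thesis
    by (simp add: total_variation_def sum.distrib add_divide_distrib flip: sum_distrib_left)
qed

text \<open>The function \<open>sgn (g u)\<close> is the test function of the pair of positive and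
  negative sets of \<open>g\<close>, and the sum on the left is the size of their union. If
  \<open>g\<close> vanishes identically this pair is not admissible, but both sides are 0.\<close>

lemma cheeger_le_total_variation_sgn:
  assumes graph: "signed_graph \<Gamma>"
  shows "signed_cheeger \<Gamma> const_measure * (\<Sum>u\<in>UNIV. \<bar>sgn (g u)\<bar>) \<le> total_variation \<Gamma> (\<lambda>u. sgn (g u))"
proof (cases "\<exists>u. g u \<noteq> 0")
  case True
  let ?P = "{u. g u > 0}" and ?N = "{u. g u < 0}"
  have disj: "?P \<inter> ?N = {}" and "?P \<union> ?N \<noteq> {}"
    using True by (auto simp: neq_iff)
  have "(\<Sum>u\<in>UNIV. \<bar>sgn (g u)\<bar>) = (\<Sum>u\<in>UNIV. indicator (?P \<union> ?N) u)"
    by (rule sum.cong) (auto simp: sgn_if indicator_def)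
  then have card: "(\<Sum>u\<in>UNIV. \<bar>sgn (g u)\<bar>) = card (?P \<union> ?N)"
    by (simp only: sum_indicator_UNIV)
  have "card (?P \<union> ?N) > 0"
    using \<open>?P \<union> ?N \<noteq> {}\<close> by (simp only: card_gt_0_iff finite simp_thms)
  moreover have "(\<lambda>u. sgn (g u)) = (\<lambda>u. indicator ?P u - indicator ?N u)"
    by (auto simp: sgn_if indicator_def)
  ultimately show ?thesis
    using signed_cheeger_le[OF disj \<open>?P \<union> ?N \<noteq> {}\<close>, of \<Gamma> const_measure]
    unfolding card signed_beta_const_measure[OF graph disj] by (simp add: pos_le_divide_eq)
qed (simp add: total_variation_def)

text \<open>The discrete coarea inequality: peel off the lowest level set of \<open>\<bar>g\<bar>\<close>, which strictly shrinks
  the support.\<close>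

lemma cheeger_le_total_variation:
  assumes graph: "signed_graph \<Gamma>"
  shows "signed_cheeger \<Gamma> const_measure * (\<Sum>u\<in>UNIV. \<bar>g u\<bar>) \<le> total_variation \<Gamma> g"
proof (induction "card {u. g u \<noteq> 0}" arbitrary: g rule: less_induct)
  case less
  show ?case
  proof (cases "{u. g u \<noteq> 0} = {}")
    case True
    then show ?thesis
      by (simp add: total_variation_def)
  next
    case False
    define m where "m = Min ((\<lambda>u. \<bar>g u\<bar>) ` {u. g u \<noteq> 0})"
    have "m \<in> (\<lambda>u. \<bar>g u\<bar>) ` {u. g u \<noteq> 0}"
      unfolding m_def using False by (intro Min_in) auto
    then obtain w where w: "g w \<noteq> 0" "m = \<bar>g w\<bar>"
      by blast
    have m: "m > 0" "g u = 0 \<or> m \<le> \<bar>g u\<bar>" for u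
    proof -
      show "m > 0"
        using w by simp
      show "g u = 0 \<or> m \<le> \<bar>g u\<bar>"
        unfolding m_def by (cases "g u = 0") (auto intro!: Min_le)
    qed
    let ?g = "\<lambda>u. g u - m * sgn (g u)"
    have "?g w = 0"
      using w by (simp add: sgn_if)
    then have "{u. ?g u \<noteq> 0} \<subset> {u. g u \<noteq> 0}"
      using w by auto
    then have "card {u. ?g u \<noteq> 0} < card {u. g u \<noteq> 0}"
      by (intro psubset_card_mono) auto
    then have IH: "signed_cheeger \<Gamma> const_measure * (\<Sum>u\<in>UNIV. \<bar>?g u\<bar>) \<le> total_variation \<Gamma> ?g"
      by (rule less)
    \<comment> \<open>With \<open>b = 0\<close> the level identity splits the absolute value just as
      the total variation splits, so the inequalities for the two pieces can be added.\<close>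
    have "\<bar>g u\<bar> = \<bar>?g u\<bar> + m * \<bar>sgn (g u)\<bar>" for u
      using abs_diff_level_decomposition[of m "g u" 0] m(1) m(2)[of u] by simp
    then have "(\<Sum>u\<in>UNIV. \<bar>g u\<bar>) = (\<Sum>u\<in>UNIV. \<bar>?g u\<bar>) + m * (\<Sum>u\<in>UNIV. \<bar>sgn (g u)\<bar>)"
      by (simp only: sum.distrib sum_distrib_left)
    moreover have "total_variation \<Gamma> g
        = total_variation \<Gamma> ?g + m * total_variation \<Gamma> (\<lambda>u. sgn (g u))"
      using m by (intro total_variation_level_decomposition[OF graph]) auto
    moreover have "m * (signed_cheeger \<Gamma> const_measure * (\<Sum>u\<in>UNIV. \<bar>sgn (g u)\<bar>))
        \<le> m * total_variation \<Gamma> (\<lambda>u. sgn (g u))"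
      using m(1) cheeger_le_total_variation_sgn[OF graph] by (intro mult_left_mono) auto
    ultimately show ?thesis
      using IH by (simp add: algebra_simps)
  qed
qed

section \<open>Lower bound on the Cheeger constant\<close>

lemma lambda_1_le_cheeger:
  assumes graph: "signed_graph \<Gamma>"
  shows "lambda_1 (signed_laplacian \<Gamma>) / 2 \<le> signed_cheeger \<Gamma> const_measure"
proof -
  let ?s = "\<lambda>u v. real_of_int (signature \<Gamma> {u, v})"
  obtain V\<^sub>1 V\<^sub>2 where V: "V\<^sub>1 \<inter> V\<^sub>2 = {}" "V\<^sub>1 \<union> V\<^sub>2 \<noteq> {}"
    "signed_cheeger \<Gamma> const_measure = signed_beta \<Gamma> const_measure V\<^sub>1 V\<^sub>2"
    by (rule signed_cheeger_attained)
  define y :: "real^'a" where "y = (\<chi> u. indicator V\<^sub>1 u - indicator V\<^sub>2 u)"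
  have y: "y $ u \<in> {-1, 0, 1}" for u
    by (auto simp: y_def indicator_def)
  \<comment> \<open>By disjointness each squared entry is the indicator of the union, so the
    Rayleigh denominator is the volume in \<open>signed_beta\<close>.\<close>
  have "y \<bullet> y = (\<Sum>u\<in>UNIV. indicator (V\<^sub>1 \<union> V\<^sub>2) u)"
    unfolding inner_vec_def
    by (rule sum.cong) (use V(1) in \<open>auto simp: y_def indicator_def\<close>)
  then have yy: "y \<bullet> y = card (V\<^sub>1 \<union> V\<^sub>2)"
    by (simp only: sum_indicator_UNIV)
  have card: "card (V\<^sub>1 \<union> V\<^sub>2) > 0"
    using V(2) by (simp only: card_gt_0_iff finite simp_thms)
  \<comment> \<open>All differences have absolute value at most 2, so squaring costs at most a
    factor 2; this is the source of the 1/2 in the lower bound.\<close>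
  have "weight \<Gamma> u v * (y$u - ?s u v * y$v)\<^sup>2 \<le> 2 * (weight \<Gamma> u v * \<bar>y$u - ?s u v * y$v\<bar>)" for u v
  proof (cases "{u, v} \<in> edges \<Gamma>")
    case True
    then have "(y$u - ?s u v * y$v)\<^sup>2 \<le> 2 * \<bar>y$u - ?s u v * y$v\<bar>"
      using y[of u] y[of v] by (cases rule: signature_cases[OF graph]) auto
    from mult_left_mono[OF this weight_nonneg[OF graph, of u v]] show ?thesis
      by (simp only: mult.left_commute[of 2])
  qed (simp add: weight_nonedge[OF graph])
  then have "y \<bullet> (signed_laplacian \<Gamma> *v y) \<le> 2 * total_variation \<Gamma> (\<lambda>u. y $ u)"
    unfolding inner_signed_laplacian[OF graph] total_variation_def
    by (simp add: sum_distrib_left sum_mono)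
  moreover have "lambda_1 (signed_laplacian \<Gamma>) * (y \<bullet> y) \<le> y \<bullet> (signed_laplacian \<Gamma> *v y)"
    by (rule symmetric_eigenvalue_minimum[OF transpose_signed_laplacian[OF graph]]) blast
  ultimately have "lambda_1 (signed_laplacian \<Gamma>) * card (V\<^sub>1 \<union> V\<^sub>2)
      \<le> 2 * total_variation \<Gamma> (\<lambda>u. indicator V\<^sub>1 u - indicator V\<^sub>2 u)"
    unfolding yy by (simp add: y_def)
  then show ?thesis
    unfolding V(3) signed_beta_const_measure[OF graph V(1)]
    using card by (simp add: field_simps)
qed

section \<open>Upper bound on the Cheeger constant\<close>

text \<open>For equal signs this is the factorisation of a difference of squares, with equality. For
  opposite signs the right side is the square of \<open>\<bar>a\<bar> + \<bar>b\<bar>\<close>, which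
  dominates the sum of the squares.\<close>

lemma abs_diff_signed_square_le:
  fixes a b :: real
  shows "\<bar>a * \<bar>a\<bar> - b * \<bar>b\<bar>\<bar> \<le> \<bar>a - b\<bar> * (\<bar>a\<bar> + \<bar>b\<bar>)"
proof (cases "a * b \<ge> 0")
  case True
  then have "\<bar>a * \<bar>a\<bar> - b * \<bar>b\<bar>\<bar> = \<bar>(a - b) * (\<bar>a\<bar> + \<bar>b\<bar>)\<bar>"
    by (auto simp: zero_le_mult_iff algebra_simps)
  then show ?thesis
    by (simp add: abs_mult)
next
  case False
  then have "\<bar>a - b\<bar> = \<bar>a\<bar> + \<bar>b\<bar>"
    by (auto simp: not_le mult_less_0_iff)
  moreover have "\<bar>a * \<bar>a\<bar> - b * \<bar>b\<bar>\<bar> \<le> \<bar>a\<bar> * \<bar>a\<bar> + \<bar>b\<bar> * \<bar>b\<bar>"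
    using abs_triangle_ineq4[of "a * \<bar>a\<bar>" "b * \<bar>b\<bar>"] by (simp add: abs_mult)
  moreover have "0 \<le> \<bar>a\<bar> * \<bar>b\<bar>"
    by simp
  ultimately show ?thesis
    by (simp only: distrib_left distrib_right mult.commute[of "\<bar>b\<bar>" "\<bar>a\<bar>"])
qed

lemma total_variation_signed_square_le:
  assumes graph: "signed_graph \<Gamma>"
  shows "total_variation \<Gamma> (\<lambda>u. x$u * \<bar>x$u\<bar>)
    \<le> sqrt (2 * max_degree \<Gamma> * (x \<bullet> x) * (x \<bullet> (signed_laplacian \<Gamma> *v x)))"
proof -
  let ?s = "\<lambda>u v. real_of_int (signature \<Gamma> {u, v})"
  \<comment> \<open>Each weight is split into two square roots, so that Cauchy-Schwarz over ordered
    pairs separates the Laplacian form (\<open>?f\<close>) from a degree-weighted norm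
    (\<open>?g\<close>).\<close>
  let ?f = "\<lambda>(u, v). sqrt (weight \<Gamma> u v) * \<bar>x$u - ?s u v * x$v\<bar>"
  let ?g = "\<lambda>(u, v). sqrt (weight \<Gamma> u v) * (\<bar>x$u\<bar> + \<bar>x$v\<bar>)"
  have "weight \<Gamma> u v * \<bar>x$u * \<bar>x$u\<bar> - ?s u v * (x$v * \<bar>x$v\<bar>)\<bar> \<le> ?f (u, v) * ?g (u, v)" for u v
  proof (cases "{u, v} \<in> edges \<Gamma>")
    case True
    then have "\<bar>x$u * \<bar>x$u\<bar> - ?s u v * (x$v * \<bar>x$v\<bar>)\<bar> \<le> \<bar>x$u - ?s u v * x$v\<bar> * (\<bar>x$u\<bar> + \<bar>x$v\<bar>)"
      using abs_diff_signed_square_le[of "x$u" "?s u v * x$v"]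
      by (cases rule: signature_cases[OF graph]) auto
    from mult_left_mono[OF this weight_nonneg[OF graph, of u v]] show ?thesis
      using weight_nonneg[OF graph, of u v] by (simp add: mult_ac flip: mult.assoc[of "sqrt _" "sqrt _"])
  qed (simp add: weight_nonedge[OF graph])
  then have "2 * total_variation \<Gamma> (\<lambda>u. x$u * \<bar>x$u\<bar>) \<le> (\<Sum>p\<in>UNIV. ?f p * ?g p)"
    unfolding total_variation_def UNIV_Times_UNIV[symmetric] sum.cartesian_product'
    by (simp add: sum_mono)
  then have "(2 * total_variation \<Gamma> (\<lambda>u. x$u * \<bar>x$u\<bar>))\<^sup>2 \<le> (\<Sum>p\<in>UNIV. ?f p * ?g p)\<^sup>2"
    by (intro power_mono) (simp_all add: total_variation_nonneg[OF graph])
  also have "\<dots> \<le> (\<Sum>p\<in>UNIV. (?f p)\<^sup>2) * (\<Sum>p\<in>UNIV. (?g p)\<^sup>2)"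
    by (rule Cauchy_Schwarz_ineq_sum)
  finally have CS: "(2 * total_variation \<Gamma> (\<lambda>u. x$u * \<bar>x$u\<bar>))\<^sup>2
      \<le> (\<Sum>p\<in>UNIV. (?f p)\<^sup>2) * (\<Sum>p\<in>UNIV. (?g p)\<^sup>2)" .
  have F: "(\<Sum>p\<in>UNIV. (?f p)\<^sup>2) = 2 * (x \<bullet> (signed_laplacian \<Gamma> *v x))"
    unfolding inner_signed_laplacian[OF graph] UNIV_Times_UNIV[symmetric] sum.cartesian_product'
    by (simp add: power_mult_distrib weight_nonneg[OF graph])
  \<comment> \<open>The 4 is a factor 2 from bounding the squared sum, times 2 because every vertex
    occurs in both positions of a pair.\<close>
  have "(\<Sum>p\<in>UNIV. (?g p)\<^sup>2) \<le> 4 * (max_degree \<Gamma> * (x \<bullet> x))"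
  proof -
    have "(\<bar>a\<bar> + \<bar>b\<bar>)\<^sup>2 \<le> 2 * (a\<^sup>2 + b\<^sup>2)" for a b :: real
      using zero_le_power2[of "\<bar>a\<bar> - \<bar>b\<bar>"] unfolding power2_sum power2_diff by simp
    then have "(\<Sum>p\<in>UNIV. (?g p)\<^sup>2)
        \<le> (\<Sum>u\<in>UNIV. \<Sum>v\<in>UNIV. weight \<Gamma> u v * (2 * ((x$u)\<^sup>2 + (x$v)\<^sup>2)))"
      unfolding UNIV_Times_UNIV[symmetric] sum.cartesian_product'
      by (simp add: power_mult_distrib weight_nonneg[OF graph] sum_mono mult_left_mono
          del: distrib_left_numeral)
    also have "\<dots> = 4 * (\<Sum>u\<in>UNIV. degree \<Gamma> u * (x$u)\<^sup>2)"
      by (simp add: distrib_left sum.distrib mult.left_commute[of _ 2] sum_weight_left[OF graph]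
          sum_weight_right[OF graph] flip: sum_distrib_left)
    also have "\<dots> \<le> 4 * (\<Sum>u\<in>UNIV. max_degree \<Gamma> * (x$u)\<^sup>2)"
      by (intro mult_left_mono sum_mono mult_right_mono) (auto simp: max_degree_def)
    finally show ?thesis
      by (simp add: inner_vec_def power2_eq_square flip: sum_distrib_left)
  qed
  then have "(\<Sum>p\<in>UNIV. (?f p)\<^sup>2) * (\<Sum>p\<in>UNIV. (?g p)\<^sup>2)
      \<le> (\<Sum>p\<in>UNIV. (?f p)\<^sup>2) * (4 * (max_degree \<Gamma> * (x \<bullet> x)))"
    by (intro mult_left_mono sum_nonneg) auto
  with CS have "(total_variation \<Gamma> (\<lambda>u. x$u * \<bar>x$u\<bar>))\<^sup>2
      \<le> 2 * max_degree \<Gamma> * (x \<bullet> x) * (x \<bullet> (signed_laplacian \<Gamma> *v x))"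
    unfolding F by (simp add: power_mult_distrib mult_ac)
  then show ?thesis
    by (rule real_le_rsqrt)
qed

lemma cheeger_le_sqrt_lambda_1:
  assumes graph: "signed_graph \<Gamma>"
  shows "signed_cheeger \<Gamma> const_measure \<le> sqrt (2 * max_degree \<Gamma> * lambda_1 (signed_laplacian \<Gamma>))"
proof -
  obtain x where x: "norm x = 1" "signed_laplacian \<Gamma> *v x = lambda_1 (signed_laplacian \<Gamma>) *\<^sub>R x"
    by (rule symmetric_eigenvalue_minimum[OF transpose_signed_laplacian[OF graph]])
  have xx: "x \<bullet> x = 1"
    using x(1) by (simp add: norm_eq_1)
  \<comment> \<open>The signed square turns the Euclidean normalisation of \<open>x\<close> into the
    sum normalisation that the coarea inequality uses.\<close>
  then have "(\<Sum>u\<in>UNIV. \<bar>x$u * \<bar>x$u\<bar>\<bar>) = 1"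
    by (simp add: inner_vec_def abs_mult)
  then have "signed_cheeger \<Gamma> const_measure \<le> total_variation \<Gamma> (\<lambda>u. x$u * \<bar>x$u\<bar>)"
    using cheeger_le_total_variation[OF graph, of "\<lambda>u. x$u * \<bar>x$u\<bar>"] by simp
  also have "\<dots> \<le> sqrt (2 * max_degree \<Gamma> * lambda_1 (signed_laplacian \<Gamma>))"
    using total_variation_signed_square_le[OF graph, of x] xx x(2) by simp
  finally show ?thesis .
qed

theorem theorem4p3:
  fixes \<Gamma> :: "('v::finite) weighted_signed_graph"
  assumes "signed_graph \<Gamma>"
  shows "lambda_1 (signed_laplacian \<Gamma>) / 2 \<le> signed_cheeger \<Gamma> const_measure
    \<and> signed_cheeger \<Gamma> const_measure \<le> sqrt (2 * max_degree \<Gamma> * lambda_1 (signed_laplacian \<Gamma>))"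
  using lambda_1_le_cheeger[OF assms] cheeger_le_sqrt_lambda_1[OF assms] by blast

end
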